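(* Let $\mu$, $m$, $G_{2m}$, $\nu$ be as in the context, and let $\gamma_n^{(m)}$, $a_j^{(n,m)}$ ($n\ge0$, $1\le j\le2m$) be the coefficients in the connection formula $$\gamma_n^{(m)}G_{2m}(z)R_n(z;\nu)=R_{n+2m}(z;\mu)+\sum_{j=1}^m a_{2j-1}^{(n,m)}z^{j-1}R_{n+2m-2j+1}(z;\mu)+\sum_{j=1}^m a_{2j}^{(n,m)}z^{j}R_{n+2m-2j}(z;\mu),\quad n\ge0.$$ Let $N=n+2m$. Then the coefficients $\gamma_n^{(m)}$ satisfy $$\frac{\gamma_n^{(m)}}{\gamma_{n-1}^{(m)}}=\frac12\left[[1-ic_{N-1}(\mu)]\,\frac{[1-ic_N(\mu)]+a_1^{(n,m)}}{[1-ic_{N-1}(\mu)]+a_1^{(n-1,m)}}+[1+ic_N(\mu)]\right],\quad n\ge1,$$ with $\gamma_0^{(m)}=\big[\overline{G_{2m}(0)}\big]^{-1}\prod_{j=1}^{2m}[1+ic_j(\mu)]$. Furthermore, the coefficients $c_n(\nu)$ and $g_n(\nu)$ corresponding to the measure $\nu$ are, for $n\ge1$, $$c_n(\nu)=\frac i2\,\frac{\gamma_{n-1}^{(m)}}{\gamma_n^{(m)}}\left[[1-ic_{N-1}(\mu)]\,\frac{[1-ic_N(\mu)]+a_1^{(n,m)}}{[1-ic_{N-1}(\mu)]+a_1^{(n-1,m)}}-[1+ic_N(\mu)]\right]$$ and $$g_n(\nu)=1-\frac{\gamma_{n-1}^{(m)}}{\gamma_n^{(m)}}\,\frac{\xi_N(\mu)+\sum_{j=1}^m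 a_{2j-1}^{(n,m)}\xi_{N-2j+1}(\mu)+\sum_{j=1}^m a_{2j}^{(n,m)}\xi_{N-2j}(\mu)}{\xi_{N-1}(\mu)+\sum_{j=1}^m a_{2j-1}^{(n-1,m)}\xi_{N-2j}(\mu)+\sum_{j=1}^m a_{2j}^{(n-1,m)}\xi_{N-2j-1}(\mu)}.$$
   Context: $\mathbb T=\{\zeta\in\mathbb C:|\zeta|=1\}$. $\mu$ is a nontrivial (i.e. with infinite support) positive measure on $\mathbb T$. $m\ge1$ is an integer and $G_{2m}$ is a polynomial of exact degree $2m$, self-reciprocal ($z^{2m}\overline{G_{2m}(1/\overline z)}=G_{2m}(z)$), with $G_{2m}(\zeta)/\zeta^m\ge0$ on $\operatorname{supp}(\mu)$; $\nu$ is the positive measure $d\nu(\zeta)=\frac{G_{2m}(\zeta)}{\zeta^m}\,d\mu(\zeta)=|G_{2m}(\zeta)|\,d\mu(\zeta)$. For any nontrivial positive measure $\sigma$ on $\mathbb T$ (in particular $\sigma=\mu$ or $\nu$): $\varphi_n(z;\sigma)$ are the orthonormal polynomials ($\deg\varphi_n=n$, leading coefficient positive), $\Phi_n(z;\sigma)$ the monic orthogonal polynomials, $\Phi_n^*(z;\sigma)=z^n\overline{\Phi_n(1/\overline z;\sigma)}$, $K_n(z,w;\sigma)=\sum_{k=0}^n\overline{\varphi_k(w;\sigma)}\varphi_k(z;\sigma)$ the Christoffel-Darboux kernels, $\alpha_n(\sigma)=-\overline{\Phi_{n+1}(0;\sigma)}$ ($n\ge0$) the Verblunsky coefficients, $\tau_n(\sigma)=\Phi_n(1;\sigma)/\Phi_n^*(1;\sigma)$,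 and for $n\ge1$ (omitting $\sigma$) $$g_n=\frac12\,\frac{|1-\tau_{n-1}\alpha_{n-1}|^2}{1-\operatorname{Re}(\tau_{n-1}\alpha_{n-1})},\qquad c_n=\frac{\operatorname{Im}(\tau_{n-1}\alpha_{n-1})}{\operatorname{Re}(\tau_{n-1}\alpha_{n-1})-1}.$$ Further $\xi_0(\sigma)=\int_{\mathbb T}d\sigma$, $\xi_n(\sigma)=\xi_0(\sigma)\prod_{j=1}^n(1-g_j(\sigma))$ for $n\ge1$, and the normalized kernels are $R_n(z;\sigma)=\xi_n(\sigma)K_n(z,1;\sigma)$, $n\ge0$. The coefficients $a_j^{(n,m)}$ in the connection formula are determined by requiring its right-hand side to vanish at the zeros of $G_{2m}$ (counted with multiplicity, i.e. with the corresponding derivatives at multiple zeros); $\gamma_n^{(m)}$ is then the constant making the formula an identity in $z$.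
   Formalization: As printed the formulas fail by powers of 2 (Lebesgue measure, m=1, G=(z+1)^2 gives gamma_0=1/4, not 1). Proved instead: a_1 is replaced by 2a_1 (at n and n-1) in the gamma ratio and c_n(nu) formulas, and each factor 1+ic_j in gamma_0 is divided by 2; the g_n(nu) formula is unchanged. *)

theory Defs
  imports "HOL-Analysis.Analysis" "HOL-Computational_Algebra.Polynomial"
begin

definition measure_supp :: "complex measure \<Rightarrow> complex set" where
  "measure_supp \<sigma> = {z. \<forall>U. open U \<and> z \<in> U \<longrightarrow> emeasure \<sigma> U > 0}"

text \<open>A measure on the unit circle is a finite Borel measure on the complex plane for which
  the complement of the circle is a null set.\<close>

definition nontrivial_circle_measure :: "complex measure \<Rightarrow> bool" where
  "nontrivial_circle_measure \<sigma> \<longleftrightarrow>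
     sets \<sigma> = sets borel \<and> finite_measure \<sigma> \<and> emeasure \<sigma> (- sphere 0 1) = 0 \<and>
     infinite (measure_supp \<sigma>)"

definition is_orthonormal_polys :: "complex measure \<Rightarrow> (nat \<Rightarrow> complex poly) \<Rightarrow> bool" where
  "is_orthonormal_polys \<sigma> \<phi> \<longleftrightarrow>
     (\<forall>n. degree (\<phi> n) = n \<and> (\<exists>\<kappa>::real. \<kappa> > 0 \<and> lead_coeff (\<phi> n) = of_real \<kappa>)) \<and>
     (\<forall>j k. (LINT z|\<sigma>. poly (\<phi> j) z * cnj (poly (\<phi> k) z)) = (if j = k then 1 else 0))"

definition orthonormal_poly :: "complex measure \<Rightarrow> nat \<Rightarrow> complex poly" where
  "orthonormal_poly \<sigma> = (THE \<phi>. is_orthonormal_polys \<sigma> \<phi>)"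

definition monic_op :: "complex measure \<Rightarrow> nat \<Rightarrow> complex poly" where
  "monic_op \<sigma> n =
     smult (inverse (lead_coeff (orthonormal_poly \<sigma> n))) (orthonormal_poly \<sigma> n)"

text \<open>The following is the reversed polynomial for \<open>z \<noteq> 0\<close> only (\<open>1 / 0 = 0\<close>);
  it is used below at \<open>z = 1\<close>.\<close>

definition monic_op_star :: "complex measure \<Rightarrow> nat \<Rightarrow> complex \<Rightarrow> complex" where
  "monic_op_star \<sigma> n z = z ^ n * cnj (poly (monic_op \<sigma> n) (1 / cnj z))"

definition CD_kernel :: "complex measure \<Rightarrow> nat \<Rightarrow> complex \<Rightarrow> complex \<Rightarrow> complex" where
  "CD_kernel \<sigma> n z w =
     (\<Sum>k\<le>n. cnj (poly (orthonormal_poly \<sigma> k) w) * poly (orthonormal_poly \<sigma> k) z)"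

definition verblunsky :: "complex measure \<Rightarrow> nat \<Rightarrow> complex" where
  "verblunsky \<sigma> n = - cnj (poly (monic_op \<sigma> (n + 1)) 0)"

definition tau :: "complex measure \<Rightarrow> nat \<Rightarrow> complex" where
  "tau \<sigma> n = poly (monic_op \<sigma> n) 1 / monic_op_star \<sigma> n 1"

text \<open>The parameters \<open>g\<^sub>n\<close> and \<open>c\<^sub>n\<close> are meaningful for \<open>n \<ge> 1\<close> only.\<close>

definition g_param :: "complex measure \<Rightarrow> nat \<Rightarrow> real" where
  "g_param \<sigma> n =
     1 / 2 * ((cmod (1 - tau \<sigma> (n - 1) * verblunsky \<sigma> (n - 1)))\<^sup>2
              / (1 - Re (tau \<sigma> (n - 1) * verblunsky \<sigma> (n - 1))))"

definition c_param :: "complex measure \<Rightarrow> nat \<Rightarrow> real" where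
  "c_param \<sigma> n =
     Im (tau \<sigma> (n - 1) * verblunsky \<sigma> (n - 1))
     / (Re (tau \<sigma> (n - 1) * verblunsky \<sigma> (n - 1)) - 1)"

definition xi :: "complex measure \<Rightarrow> nat \<Rightarrow> real" where
  "xi \<sigma> n = (LINT z|\<sigma>. 1) * (\<Prod>j=1..n. 1 - g_param \<sigma> j)"

text \<open>With this normalization \<open>R\<^sub>n\<close> has leading coefficient
  \<open>(\<Prod>j=1..n. (1 + \<i> c\<^sub>j) / 2)\<close> and value \<open>(\<Prod>j=1..n. (1 - \<i> c\<^sub>j) / 2)\<close> at \<open>0\<close>.
  The multiples \<open>2\<^sup>n R\<^sub>n\<close> are the solutions of the three-term recurrence with
  coefficients \<open>(1 + \<i> c\<^sub>n) z + (1 - \<i> c\<^sub>n)\<close>.\<close>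

definition R_kernel :: "complex measure \<Rightarrow> nat \<Rightarrow> complex \<Rightarrow> complex" where
  "R_kernel \<sigma> n z = of_real (xi \<sigma> n) * CD_kernel \<sigma> n z 1"

definition self_reciprocal :: "nat \<Rightarrow> complex poly \<Rightarrow> bool" where
  "self_reciprocal d G \<longleftrightarrow> (\<forall>z. z \<noteq> 0 \<longrightarrow> z ^ d * cnj (poly G (1 / cnj z)) = poly G z)"

definition christoffel_measure :: "complex poly \<Rightarrow> complex measure \<Rightarrow> complex measure" where
  "christoffel_measure G \<mu> = density \<mu> (\<lambda>\<zeta>. ennreal (cmod (poly G \<zeta>)))"

definition connection_rhs ::
    "complex measure \<Rightarrow> nat \<Rightarrow> (nat \<Rightarrow> nat \<Rightarrow> complex) \<Rightarrow> nat \<Rightarrow> complex \<Rightarrow> complex" where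
  "connection_rhs \<mu> m a n z =
     R_kernel \<mu> (n + 2 * m) z
     + (\<Sum>j=1..m. a n (2 * j - 1) * z ^ (j - 1) * R_kernel \<mu> (n + 2 * m - 2 * j + 1) z)
     + (\<Sum>j=1..m. a n (2 * j) * z ^ j * R_kernel \<mu> (n + 2 * m - 2 * j) z)"

text \<open>Here \<open>a n j\<close> is \<open>a\<^sub>j\<close> for the index \<open>n\<close>. The first clause determines the \<open>a n j\<close>
  for \<open>1 \<le> j \<le> 2 m\<close>: the right-hand side vanishes at the zeros of \<open>G\<close>, with multiplicity.\<close>

definition connection_coeffs ::
    "complex measure \<Rightarrow> nat \<Rightarrow> complex poly \<Rightarrow> (nat \<Rightarrow> complex) \<Rightarrow> (nat \<Rightarrow> nat \<Rightarrow> complex) \<Rightarrow> bool" where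
  "connection_coeffs \<mu> m G \<gamma> a \<longleftrightarrow>
     (\<forall>n w k. k < order w G \<longrightarrow> (deriv ^^ k) (connection_rhs \<mu> m a n) w = 0) \<and>
     (\<forall>n z. \<gamma> n * poly G z * R_kernel (christoffel_measure G \<mu>) n z = connection_rhs \<mu> m a n z)"

end

theory Submission
  imports Defs
begin

text \<open>
  Write \<open>P\<^sub>n\<close> for the monic orthogonal polynomials. Szego's recurrence and the ensuing
  norm recurrence show that \<open>R\<^sub>n\<close> has leading coefficient \<open>\<Prod>j\<le>n. (1 + \<i> c\<^sub>j) / 2\<close> and value
  \<open>\<Prod>j\<le>n. (1 - \<i> c\<^sub>j) / 2\<close> at \<open>0\<close>, and the reproducing property of the kernel gives
  \<open>\<integral> R\<^sub>n(\<zeta>) cnj \<zeta> ^ k d\<sigma> = \<xi>\<^sub>n\<close> for \<open>0 \<le> k \<le> n\<close>. Comparing both sides of the connection formula in three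
  ways (leading coefficients, values at \<open>0\<close>, integrals against \<open>cnj \<zeta> ^ m d\<mu>\<close>, which turn \<open>G d\<mu>\<close> into
  \<open>d\<nu>\<close>) expresses \<open>\<gamma>\<^sub>n (1 + \<i> c\<^sub>n(\<nu>))\<close>, \<open>\<gamma>\<^sub>n (1 - \<i> c\<^sub>n(\<nu>))\<close> and \<open>\<gamma>\<^sub>n \<xi>\<^sub>n(\<nu>)\<close> through
  data of \<open>\<mu>\<close>; sum, difference and quotient of these are the three claims.
\<close>

section \<open>The pairing in L2 and the support of a measure\<close>

definition ip :: "complex measure \<Rightarrow> complex poly \<Rightarrow> complex poly \<Rightarrow> complex" where
  "ip \<sigma> p q = (LINT z|\<sigma>. poly p z * cnj (poly q z))"

text \<open>The complement of the support is a union of open null sets, and by Lindelof countably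
  many of them suffice. This carries a sign condition imposed only on the support over to
  integrals.\<close>

lemma AE_measure_supp:
  assumes "sets \<sigma> = sets borel"
  shows "AE z in \<sigma>. z \<in> measure_supp \<sigma>"
proof -
  define F where "F = {U. open U \<and> emeasure \<sigma> U = 0}"
  obtain F' where F': "F' \<subseteq> F" "countable F'" "\<Union>F' = \<Union>F"
    using Lindelof[of F] unfolding F_def by auto
  have "U \<in> null_sets \<sigma>" if "U \<in> F'" for U
    using that F'(1) assms by (auto simp: F_def null_sets_def)
  with F'(2) have "\<Union>F' \<in> null_sets \<sigma>"
    using null_sets_UN'[of F' "\<lambda>x. x" \<sigma>] by simp
  moreover have "\<Union>F = - measure_supp \<sigma>"
    by (auto simp: F_def measure_supp_def not_gr_zero)
  ultimately have "- measure_supp \<sigma> \<in> null_sets \<sigma>"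
    using F'(3) by simp
  then show ?thesis
    by (rule AE_I') auto
qed

section \<open>Reversed polynomials and numbers of modulus one\<close>

text \<open>Reversal is with respect to the actual degree. Being a polynomial, it also has the right
  value at 0, where the pointwise formula with 1 / cnj z breaks down.\<close>

definition rev_poly :: "complex poly \<Rightarrow> complex poly" where
  "rev_poly p = reflect_poly (map_poly cnj p)"

lemma degree_map_poly_cnj [simp]: "degree (map_poly cnj p) = degree p"
  by (rule degree_map_poly) auto

lemma poly_map_poly_cnj: "poly (map_poly cnj p) z = cnj (poly p (cnj z))"
  by (induction p) (auto simp: map_poly_pCons)

lemma degree_rev_poly_le: "degree (rev_poly p) \<le> degree p"
  unfolding rev_poly_def using degree_reflect_poly_le[of "map_poly cnj p"] by simp

lemma poly_rev_poly_0: "poly (rev_poly p) 0 = cnj (lead_coeff p)"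
  by (simp add: rev_poly_def coeff_map_poly)

lemma cnj_eq_inverse_of_unit: "cmod z = 1 \<Longrightarrow> cnj z = inverse z"
  by (simp add: inverse_complex_def complex_eq_iff cmod_def)

lemma mult_cnj_of_unit: "cmod z = 1 \<Longrightarrow> z * cnj z = 1"
  by (simp add: complex_norm_square[symmetric])

lemma poly_rev_poly:
  assumes "cmod z = 1"
  shows "poly (rev_poly p) z = z ^ degree p * cnj (poly p z)"
proof -
  have "z \<noteq> 0" using assms by auto
  moreover have "cnj (inverse z) = z"
    using cnj_eq_inverse_of_unit[OF assms] by (metis complex_cnj_cnj)
  ultimately show ?thesis
    by (simp add: rev_poly_def poly_reflect_poly_nz poly_map_poly_cnj)
qed

lemma of_real_cmod_power2: "(complex_of_real (cmod z))\<^sup>2 = z * cnj z"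
  by (simp flip: complex_norm_square of_real_power)

lemma one_plus_i_of_real_nonzero [simp]: "1 + \<i> * complex_of_real x \<noteq> 0"
  and one_minus_i_of_real_nonzero [simp]: "1 - \<i> * complex_of_real x \<noteq> 0"
  by (auto simp: complex_eq_iff)

lemma degree_diff_monic_less:
  fixes p q :: "complex poly"
  assumes "degree p = n" "lead_coeff p = 1" "degree q = n" "lead_coeff q = 1"
  shows "degree (p - q) < n \<or> p - q = 0"
proof -
  have "degree (p - q) \<le> n" using assms by (simp add: degree_diff_le)
  moreover have "coeff (p - q) n = 0" using assms by simp
  ultimately show ?thesis
    using eq_zero_or_degree_less by blast
qed

section \<open>The Hermitian form of a measure on the circle\<close>

locale circle_measure =
  fixes \<sigma> :: "complex measure"
  assumes nontrivial: "nontrivial_circle_measure \<sigma>"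
begin

lemma sets_eq [measurable_cong, simp]: "sets \<sigma> = sets borel"
  using nontrivial by (simp add: nontrivial_circle_measure_def)

lemma space_eq [simp]: "space \<sigma> = UNIV"
  using sets_eq sets_eq_imp_space_eq by fastforce

sublocale finite_measure \<sigma>
  using nontrivial by (simp add: nontrivial_circle_measure_def)

lemma AE_circle: "AE z in \<sigma>. cmod z = 1"
proof (rule AE_I')
  show "- sphere 0 1 \<in> null_sets \<sigma>"
    using nontrivial by (auto simp: nontrivial_circle_measure_def null_sets_def)
qed auto

text \<open>Almost every point lies on the circle, where compactness bounds \<open>f\<close>; the
  measure is finite.\<close>

lemma integrable_continuous:
  fixes f :: "complex \<Rightarrow> complex"
  assumes "continuous_on UNIV f"
  shows "integrable \<sigma> f"
proof -
  have "compact (f ` sphere 0 1)"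
    by (intro compact_continuous_image continuous_on_subset[OF assms]) auto
  then obtain B where B: "\<forall>x\<in>f ` sphere 0 1. norm x \<le> B"
    using compact_imp_bounded bounded_iff by metis
  have "AE z in \<sigma>. norm (f z) \<le> B"
    using AE_circle by eventually_elim (use B in auto)
  moreover have "f \<in> borel_measurable \<sigma>"
    using borel_measurable_continuous_onI[OF assms] by simp
  ultimately show ?thesis
    by (intro integrable_const_bound)
qed

lemma integrable_ip: "integrable \<sigma> (\<lambda>z. poly p z * cnj (poly q z))"
  by (intro integrable_continuous continuous_intros)

lemma ip_cong:
  assumes "\<And>z. cmod z = 1 \<Longrightarrow> poly p z * cnj (poly q z) = poly p' z * cnj (poly q' z)"
  shows "ip \<sigma> p q = ip \<sigma> p' q'"
  unfolding ip_def
proof (rule integral_cong_AE)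
  show "AE z in \<sigma>. poly p z * cnj (poly q z) = poly p' z * cnj (poly q' z)"
    using AE_circle by eventually_elim (rule assms)
qed (use integrable_ip in auto)

lemma ip_add_left: "ip \<sigma> (p + q) r = ip \<sigma> p r + ip \<sigma> q r"
  unfolding ip_def using integrable_ip by (simp add: distrib_right)

lemma ip_diff_left: "ip \<sigma> (p - q) r = ip \<sigma> p r - ip \<sigma> q r"
  unfolding ip_def using integrable_ip by (simp add: left_diff_distrib)

lemma ip_smult_left: "ip \<sigma> (smult c p) r = c * ip \<sigma> p r"
  unfolding ip_def by (simp add: mult.assoc)

lemma ip_0_left [simp]: "ip \<sigma> 0 r = 0"
  by (simp add: ip_def)

lemma ip_sum_left: "ip \<sigma> (sum f A) r = (\<Sum>x\<in>A. ip \<sigma> (f x) r)"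
  by (induction A rule: infinite_finite_induct) (auto simp: ip_add_left)

lemma cnj_ip: "cnj (ip \<sigma> p q) = ip \<sigma> q p"
proof -
  have "cnj (ip \<sigma> p q) = (LINT z|\<sigma>. cnj (poly p z * cnj (poly q z)))"
    unfolding ip_def by (rule Bochner_Integration.integral_cnj[symmetric])
  then show ?thesis by (simp add: ip_def mult.commute)
qed

lemma ip_smult_right: "ip \<sigma> p (smult c q) = cnj c * ip \<sigma> p q"
  by (metis cnj_ip complex_cnj_mult ip_smult_left)

lemma ip_sum_right: "ip \<sigma> p (sum f A) = (\<Sum>x\<in>A. ip \<sigma> p (f x))"
  using arg_cong[OF ip_sum_left[of f A p], of cnj] by (simp add: cnj_ip)

lemma ip_diff_right: "ip \<sigma> r (p - q) = ip \<sigma> r p - ip \<sigma> r q"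
  using arg_cong[OF ip_diff_left[of p q r], of cnj] by (simp add: cnj_ip)

text \<open>Multiplication by z is an isometry because |z| = 1 almost everywhere.\<close>

lemma ip_shift: "ip \<sigma> (monom 1 k * p) (monom 1 k * q) = ip \<sigma> p q"
proof (rule ip_cong)
  fix z :: complex
  assume "cmod z = 1"
  then have "z ^ k * cnj z ^ k = 1"
    by (simp flip: power_mult_distrib add: mult_cnj_of_unit)
  then show "poly (monom 1 k * p) z * cnj (poly (monom 1 k * q) z) = poly p z * cnj (poly q z)"
    by (simp add: poly_monom algebra_simps)
qed

lemma ip_self_eq: "ip \<sigma> p p = of_real (Re (ip \<sigma> p p))"
  using cnj_ip[of p p] by (simp add: complex_eq_iff)

text \<open>Definiteness comes from the infinite support: a zero norm makes the open set where p
  does not vanish a null set, so the support would lie among the finitely many roots of p.\<close>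

lemma ip_self_pos:
  assumes "p \<noteq> 0"
  shows "Re (ip \<sigma> p p) > 0"
proof -
  have eq: "ip \<sigma> p p = of_real (LINT z|\<sigma>. (cmod (poly p z))\<^sup>2)"
    unfolding ip_def by (simp flip: complex_norm_square of_real_power)
  have int: "integrable \<sigma> (\<lambda>z. (cmod (poly p z))\<^sup>2)"
    using integrable_norm[OF integrable_ip[of p p]] by (simp add: norm_mult power2_eq_square)
  have "(LINT z|\<sigma>. (cmod (poly p z))\<^sup>2) \<noteq> 0"
  proof
    assume "(LINT z|\<sigma>. (cmod (poly p z))\<^sup>2) = 0"
    then have "AE z in \<sigma>. poly p z = 0"
      by (subst (asm) integral_nonneg_eq_0_iff_AE[OF int]) auto
    moreover have op: "open {z. poly p z \<noteq> 0}"
      by (intro open_Collect_neq continuous_intros)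
    ultimately have null: "emeasure \<sigma> {z. poly p z \<noteq> 0} = 0"
      by (subst (asm) AE_iff_measurable[OF _ refl]) auto
    have "measure_supp \<sigma> \<subseteq> {z. poly p z = 0}"
      using null op by (auto simp: measure_supp_def)
    then have "finite (measure_supp \<sigma>)"
      using poly_roots_finite[OF assms] finite_subset by blast
    then show False
      using nontrivial by (simp add: nontrivial_circle_measure_def)
  qed
  moreover have "(LINT z|\<sigma>. (cmod (poly p z))\<^sup>2) \<ge> 0"
    by (rule integral_nonneg_AE) auto
  ultimately have "(LINT z|\<sigma>. (cmod (poly p z))\<^sup>2) > 0"
    by linarith
  then show ?thesis by (simp add: eq)
qed

lemma ip_self_nonzero: "p \<noteq> 0 \<Longrightarrow> ip \<sigma> p p \<noteq> 0"
  using ip_self_pos[of p] by auto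

end

section \<open>Monic orthogonal polynomials from Szego's recurrence\<close>

text \<open>Defining the monic orthogonal polynomials by Szego's recurrence, with the coefficient that
  enforces orthogonality to \<open>1\<close>, yields their existence and the recurrence at once.\<close>

primrec szego :: "complex measure \<Rightarrow> nat \<Rightarrow> complex poly" where
  "szego \<sigma> 0 = 1"
| "szego \<sigma> (Suc n) = monom 1 1 * szego \<sigma> n
     - smult (ip \<sigma> (monom 1 1 * szego \<sigma> n) 1 / ip \<sigma> (szego \<sigma> n) (szego \<sigma> n))
         (rev_poly (szego \<sigma> n))"

declare szego.simps(2) [simp del]

context circle_measure
begin

text \<open>If P of degree n is orthogonal to 1, ..., z^(n-1), this makes its reversal orthogonal to
  z, ..., z^n, so only the pairing of the reversal with 1 survives.\<close>

lemma ip_rev_poly: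
  assumes "k \<le> degree p"
  shows "ip \<sigma> (rev_poly p) (monom 1 k) = ip \<sigma> (monom 1 (degree p - k)) p"
proof (rule ip_cong)
  fix z :: complex
  assume z: "cmod z = 1"
  have "z ^ degree p = z ^ (degree p - k) * z ^ k"
    using assms by (simp flip: power_add)
  moreover have "z ^ k * cnj z ^ k = 1"
    using z by (simp flip: power_mult_distrib add: mult_cnj_of_unit)
  ultimately show "poly (rev_poly p) z * cnj (poly (monom 1 k) z)
      = poly (monom 1 (degree p - k)) z * cnj (poly p z)"
    by (simp add: poly_rev_poly[OF z] poly_monom algebra_simps)
qed

lemma ip_right_zero:
  assumes "\<forall>k<n. ip \<sigma> p (monom 1 k) = 0" "degree q < n \<or> q = 0"
  shows "ip \<sigma> p q = 0"
proof (cases "q = 0")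
  case True
  then show ?thesis using cnj_ip[of 0 p] by simp
next
  case False
  with assms have "degree q < n" by simp
  then have "ip \<sigma> p (smult (coeff q k) (monom 1 k)) = 0" if "k \<le> degree q" for k
    using that assms by (simp only: ip_smult_right) simp
  then have "ip \<sigma> p (\<Sum>k\<le>degree q. smult (coeff q k) (monom 1 k)) = 0"
    by (simp only: ip_sum_right) simp
  then show ?thesis
    using poly_as_sum_of_monoms[of q] by (simp add: smult_monom)
qed

text \<open>Both z P and the reversal of P are orthogonal to z, ..., z^n. Against 1 the reversal
  gives the squared norm of P, so the coefficient in the recurrence removes the remaining pairing.
  The reversal has degree at most n and leaves the leading term alone.\<close>

lemma szego_monic_orthogonal:
  "degree (szego \<sigma> n) = n \<and> lead_coeff (szego \<sigma> n) = 1 \<and>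
   (\<forall>k<n. ip \<sigma> (szego \<sigma> n) (monom 1 k) = 0)"
proof (induction n)
  case 0
  then show ?case by simp
next
  case (Suc n)
  define P c where "P = szego \<sigma> n"
    and "c = ip \<sigma> (monom 1 1 * P) 1 / ip \<sigma> P P"
  have P: "degree P = n" "lead_coeff P = 1" "\<forall>k<n. ip \<sigma> P (monom 1 k) = 0"
    using Suc by (auto simp: P_def)
  have P0: "P \<noteq> 0" using P(2) by auto
  have S: "szego \<sigma> (Suc n) = monom 1 1 * P - smult c (rev_poly P)"
    by (simp add: P_def c_def szego.simps(2))
  have d1: "degree (monom 1 1 * P) = Suc n"
    using P0 P(1) by (simp add: degree_mult_eq degree_monom_eq)
  have d2: "degree (smult c (rev_poly P)) < Suc n"
    using degree_smult_le[of c "rev_poly P"] degree_rev_poly_le[of P] P(1) by linarith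
  have deg: "degree (szego \<sigma> (Suc n)) = Suc n"
    using degree_add_eq_left[of "- smult c (rev_poly P)" "monom 1 1 * P"] d1 d2 by (simp add: S)
  have "coeff (smult c (rev_poly P)) (Suc n) = 0"
    using d2 by (rule coeff_eq_0)
  moreover have "coeff (monom 1 1 * P) (Suc n) = 1"
    using P(1,2) by (simp add: coeff_monom_mult)
  ultimately have lead: "lead_coeff (szego \<sigma> (Suc n)) = 1"
    unfolding deg unfolding S coeff_diff by simp
  \<comment> \<open>P is orthogonal to lower degrees, so z^n may be replaced by P in the pairing.
    For n = 0 the difference is 0 instead of having smaller degree.\<close>
  have "degree (monom 1 n - P) < n \<or> monom 1 n - P = 0"
    using P by (intro degree_diff_monic_less) (auto simp: degree_monom_eq)
  then have "ip \<sigma> P (monom 1 n - P) = 0"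
    using ip_right_zero P(3) by blast
  then have PP: "ip \<sigma> P (monom 1 n) = ip \<sigma> P P"
    by (simp add: ip_diff_right)
  have "ip \<sigma> (szego \<sigma> (Suc n)) (monom 1 k) = 0" if "k < Suc n" for k
  proof -
    have r: "ip \<sigma> (rev_poly P) (monom 1 k) = cnj (ip \<sigma> P (monom 1 (n - k)))"
      using ip_rev_poly[of k P] that P(1) by (simp add: cnj_ip)
    show ?thesis
    proof (cases k)
      case 0
      have "cnj (ip \<sigma> P P) = ip \<sigma> P P" by (rule cnj_ip)
      then show ?thesis
        using r 0 PP ip_self_nonzero[OF P0]
        by (simp add: S ip_diff_left ip_smult_left c_def)
    next
      case (Suc l)
      have "ip \<sigma> (monom 1 1 * P) (monom 1 1 * monom 1 l) = 0"
        using ip_shift[of 1 P "monom 1 l"] P(3) Suc that by simp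
      moreover have "ip \<sigma> P (monom 1 (n - k)) = 0"
        using P(3) that Suc by simp
      ultimately show ?thesis
        using r Suc by (simp add: S ip_diff_left ip_smult_left mult_monom)
    qed
  qed
  with deg lead show ?case by blast
qed


lemma degree_szego [simp]: "degree (szego \<sigma> n) = n"
  and lead_coeff_szego [simp]: "coeff (szego \<sigma> n) n = 1"
  using szego_monic_orthogonal[of n] by auto

lemma szego_nonzero [simp]: "szego \<sigma> n \<noteq> 0"
  using lead_coeff_szego[of n] by force

lemma ip_szego_lower:
  assumes "degree q < n \<or> q = 0"
  shows "ip \<sigma> (szego \<sigma> n) q = 0"
  using ip_right_zero szego_monic_orthogonal assms by blast

lemma ip_lower_szego:
  assumes "degree q < n \<or> q = 0"
  shows "ip \<sigma> q (szego \<sigma> n) = 0"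
  using ip_szego_lower[OF assms] cnj_ip by (metis complex_cnj_zero)

section \<open>Squared norms and uniqueness of the orthonormal polynomials\<close>

definition sqnorm :: "nat \<Rightarrow> real" where
  "sqnorm n = Re (ip \<sigma> (szego \<sigma> n) (szego \<sigma> n))"

lemma sqnorm_pos [simp]: "sqnorm n > 0"
  by (simp add: sqnorm_def ip_self_pos)

lemma sqnorm_nonneg [simp]: "sqnorm n \<ge> 0"
  using sqnorm_pos[of n] by linarith

lemma sqnorm_nonzero [simp]: "sqnorm n \<noteq> 0"
  using sqnorm_pos[of n] by linarith

lemma ip_szego_szego: "ip \<sigma> (szego \<sigma> j) (szego \<sigma> k) = (if j = k then of_real (sqnorm j) else 0)"
proof (cases j k rule: linorder_cases)
  case less
  then show ?thesis using ip_lower_szego[of "szego \<sigma> j" k] by simp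
next
  case equal
  then show ?thesis using ip_self_eq[of "szego \<sigma> j"] by (simp add: sqnorm_def)
next
  case greater
  then show ?thesis using ip_szego_lower[of "szego \<sigma> k" j] by simp
qed

lemma is_orthonormal_szego:
  "is_orthonormal_polys \<sigma> (\<lambda>n. smult (of_real (1 / sqrt (sqnorm n))) (szego \<sigma> n))"
proof -
  have "ip \<sigma> (smult (of_real (1 / sqrt (sqnorm j))) (szego \<sigma> j))
      (smult (of_real (1 / sqrt (sqnorm k))) (szego \<sigma> k)) = (if j = k then 1 else 0)" for j k
    by (simp add: ip_smult_left ip_smult_right ip_szego_szego flip: of_real_mult of_real_divide)
  moreover have "\<exists>\<kappa>>0. lead_coeff (smult (of_real (1 / sqrt (sqnorm n))) (szego \<sigma> n)) = of_real \<kappa>"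
    for n
    by (rule exI[of _ "1 / sqrt (sqnorm n)"]) simp
  ultimately show ?thesis
    unfolding is_orthonormal_polys_def ip_def by simp
qed

text \<open>Subtracting a multiple of the family member of equal degree lowers the degree of q. This
  serves orthonormal systems not yet known to come from \<open>szego\<close>.\<close>

lemma ip_graded_family_zero:
  assumes deg: "\<And>k. degree (f k) = k" and nz: "\<And>k. f k \<noteq> 0"
    and orth: "\<And>k. k < n \<Longrightarrow> ip \<sigma> p (f k) = 0"
    and q: "degree q < n"
  shows "ip \<sigma> p q = 0"
  using q
proof (induction "degree q" arbitrary: q rule: less_induct)
  case less
  define c r where "c = lead_coeff q / lead_coeff (f (degree q))"
    and "r = q - smult c (f (degree q))"
  have "lead_coeff (f (degree q)) \<noteq> 0" using nz by simp
  then have "coeff r (degree q) = 0"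
    using deg[of "degree q"] by (simp add: r_def c_def)
  moreover have "degree r \<le> degree q"
    unfolding r_def using deg[of "degree q"]
    by (metis degree_diff_le degree_smult_le order_refl)
  ultimately have r: "degree r < degree q \<or> r = 0"
    using eq_zero_or_degree_less by blast
  have "ip \<sigma> p r = 0"
    using r
  proof
    assume "degree r < degree q"
    then show ?thesis using less by simp
  next
    assume "r = 0"
    then show ?thesis using cnj_ip[of 0 p] by simp
  qed
  moreover have "ip \<sigma> p (f (degree q)) = 0"
    using orth less.prems by simp
  ultimately show ?case
    by (simp add: r_def ip_diff_right ip_smult_right)
qed

text \<open>After subtracting the multiple of \<open>szego\<close> with the same leading coefficient
  c, the remainder has degree below n, yet is orthogonal to all such polynomials, itself included;
  hence it is 0. Unit norm and c > 0 then fix c.\<close>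

lemma is_orthonormal_polys_unique:
  assumes "is_orthonormal_polys \<sigma> \<psi>"
  shows "\<psi> n = smult (of_real (1 / sqrt (sqnorm n))) (szego \<sigma> n)"
proof -
  have deg: "degree (\<psi> k) = k" for k
    using assms by (simp add: is_orthonormal_polys_def)
  have orth: "ip \<sigma> (\<psi> j) (\<psi> k) = (if j = k then 1 else 0)" for j k
    using assms by (simp add: is_orthonormal_polys_def ip_def)
  have nz: "\<psi> k \<noteq> 0" for k
    using orth[of k k] by auto
  obtain c :: real where c: "c > 0" "lead_coeff (\<psi> n) = of_real c"
    using assms unfolding is_orthonormal_polys_def deg by metis
  define d where "d = \<psi> n - smult (of_real c) (szego \<sigma> n)"
  have "d = 0"
  proof (rule ccontr)
    assume "d \<noteq> 0"
    have "degree d \<le> n"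
      unfolding d_def by (intro degree_diff_le) (auto simp: deg)
    moreover have "coeff d n = 0"
      using c by (simp add: d_def deg)
    ultimately have dn: "degree d < n"
      using eq_zero_or_degree_less \<open>d \<noteq> 0\<close> by blast
    have "ip \<sigma> (\<psi> n) d = 0"
      by (rule ip_graded_family_zero[of \<psi>, OF deg nz _ dn]) (use orth in auto)
    moreover have "ip \<sigma> (szego \<sigma> n) d = 0"
      using dn ip_szego_lower by blast
    ultimately have "ip \<sigma> d d = 0"
      by (subst (1) d_def) (simp add: ip_diff_left ip_smult_left)
    then show False using ip_self_nonzero[OF \<open>d \<noteq> 0\<close>] by simp
  qed
  then have eq: "\<psi> n = smult (of_real c) (szego \<sigma> n)"
    by (simp add: d_def)
  have "complex_of_real (c * c * sqnorm n) = 1"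
    using orth[of n n] by (simp add: eq ip_smult_left ip_smult_right ip_szego_szego mult.assoc)
  then have "c * c * sqnorm n = 1"
    by (simp only: of_real_eq_1_iff)
  then have "c\<^sup>2 = 1 / sqnorm n"
    by (simp add: power2_eq_square field_simps)
  then have "sqrt (1 / sqnorm n) = c"
    using c(1) by (intro real_sqrt_unique) auto
  then have "c = 1 / sqrt (sqnorm n)"
    by (simp add: real_sqrt_divide)
  then show ?thesis by (simp add: eq)
qed

lemma orthonormal_poly_eq:
  "orthonormal_poly \<sigma> n = smult (of_real (1 / sqrt (sqnorm n))) (szego \<sigma> n)"
proof -
  have "orthonormal_poly \<sigma> = (\<lambda>n. smult (of_real (1 / sqrt (sqnorm n))) (szego \<sigma> n))"
    unfolding orthonormal_poly_def
  proof (rule the_equality)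
    fix \<psi>
    assume "is_orthonormal_polys \<sigma> \<psi>"
    then show "\<psi> = (\<lambda>n. smult (of_real (1 / sqrt (sqnorm n))) (szego \<sigma> n))"
      by (intro ext is_orthonormal_polys_unique)
  qed (rule is_orthonormal_szego)
  then show ?thesis by simp
qed

lemma monic_op_eq: "monic_op \<sigma> n = szego \<sigma> n"
  by (simp add: monic_op_def orthonormal_poly_eq less_imp_neq[OF sqnorm_pos, symmetric])

section \<open>Verblunsky coefficients and values at 1\<close>

lemma monic_op_star_1: "monic_op_star \<sigma> n 1 = cnj (poly (szego \<sigma> n) 1)"
  by (simp add: monic_op_star_def monic_op_eq)

text \<open>Evaluation at 0 identifies the coefficient: z P vanishes there and the reversal of a
  monic polynomial takes the value 1.\<close>

lemma szego_recurrence: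
  "szego \<sigma> (Suc n)
     = monom 1 1 * szego \<sigma> n - smult (cnj (verblunsky \<sigma> n)) (rev_poly (szego \<sigma> n))"
proof -
  define c where "c = ip \<sigma> (monom 1 1 * szego \<sigma> n) 1 / ip \<sigma> (szego \<sigma> n) (szego \<sigma> n)"
  have S: "szego \<sigma> (Suc n) = monom 1 1 * szego \<sigma> n - smult c (rev_poly (szego \<sigma> n))"
    by (simp add: szego.simps(2) c_def)
  have "poly (szego \<sigma> (Suc n)) 0 = - c"
    by (simp add: S poly_monom poly_rev_poly_0)
  then have "cnj (verblunsky \<sigma> n) = c"
    by (simp add: verblunsky_def monic_op_eq)
  with S show ?thesis by simp
qed

lemma szego_0_verblunsky: "poly (szego \<sigma> (Suc n)) 0 = - cnj (verblunsky \<sigma> n)"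
  by (simp add: verblunsky_def monic_op_eq)

text \<open>Pythagoras: z P is the next polynomial S plus a multiple of the reversal Q of P, and Q,
  having lower degree, is orthogonal to S. Both z P and Q have the norm of P.\<close>

lemma sqnorm_Suc: "sqnorm (Suc n) = (1 - (cmod (verblunsky \<sigma> n))\<^sup>2) * sqnorm n"
proof -
  define P S Q b where "P = szego \<sigma> n" and "S = szego \<sigma> (Suc n)" and "Q = rev_poly P"
    and "b = cnj (verblunsky \<sigma> n)"
  have zP: "monom 1 1 * P = S - smult (- b) Q"
    by (simp add: szego_recurrence P_def S_def Q_def b_def)
  have "degree Q < Suc n"
    using degree_rev_poly_le[of P] by (simp add: Q_def P_def)
  then have SQ: "ip \<sigma> S Q = 0" "ip \<sigma> Q S = 0"
    by (auto simp: S_def ip_szego_lower ip_lower_szego)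
  have QQ: "ip \<sigma> Q Q = ip \<sigma> P P"
  proof (rule ip_cong)
    fix z :: complex
    assume z: "cmod z = 1"
    then have "z ^ n * cnj z ^ n = 1"
      by (simp flip: power_mult_distrib add: mult_cnj_of_unit)
    then show "poly Q z * cnj (poly Q z) = poly P z * cnj (poly P z)"
      by (simp add: Q_def poly_rev_poly[OF z] P_def algebra_simps)
  qed
  have "ip \<sigma> P P = ip \<sigma> (S - smult (- b) Q) (S - smult (- b) Q)"
    using ip_shift[of 1 P P] by (simp only: zP)
  also have "\<dots> = ip \<sigma> S S + b * cnj b * ip \<sigma> P P"
    by (simp add: ip_diff_left ip_diff_right ip_smult_left ip_smult_right SQ QQ algebra_simps
          del: smult_minus_left)
  finally have "complex_of_real (sqnorm n)
      = of_real (sqnorm (Suc n)) + of_real ((cmod (verblunsky \<sigma> n))\<^sup>2) * of_real (sqnorm n)"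
    by (simp add: P_def S_def ip_szego_szego b_def of_real_cmod_power2 mult.commute)
  then have "sqnorm n = sqnorm (Suc n) + (cmod (verblunsky \<sigma> n))\<^sup>2 * sqnorm n"
    by (simp only: flip: of_real_add of_real_mult) (simp only: of_real_eq_iff)
  then show ?thesis by (simp add: algebra_simps)
qed

text \<open>Consecutive squared norms are positive, hence so is the factor relating them.\<close>

lemma norm_verblunsky_less_1: "cmod (verblunsky \<sigma> n) < 1"
proof -
  have "(1 - (cmod (verblunsky \<sigma> n))\<^sup>2) * sqnorm n > 0"
    using sqnorm_pos[of "Suc n"] by (simp only: sqnorm_Suc)
  then have "(cmod (verblunsky \<sigma> n))\<^sup>2 < 1"
    using sqnorm_pos[of n] by (simp only: zero_less_mult_iff) linarith
  then show ?thesis by (simp add: power_less_one_iff abs_square_less_1)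
qed

lemma szego_at_1_Suc_diff:
  "poly (szego \<sigma> (Suc n)) 1
     = poly (szego \<sigma> n) 1 - cnj (verblunsky \<sigma> n) * cnj (poly (szego \<sigma> n) 1)"
  by (simp add: szego_recurrence poly_monom poly_rev_poly)

text \<open>The correction term in the recurrence at 1 is strictly smaller in modulus than the
  previous value. This keeps the quotient \<open>tau\<close> from being a division by zero.\<close>

lemma szego_at_1_nonzero [simp]: "poly (szego \<sigma> n) 1 \<noteq> 0"
proof (induction n)
  case 0
  then show ?case by simp
next
  case (Suc n)
  have "cmod (cnj (verblunsky \<sigma> n) * cnj (poly (szego \<sigma> n) 1)) < 1 * cmod (poly (szego \<sigma> n) 1)"
    using norm_verblunsky_less_1[of n] Suc
    by (simp only: norm_mult complex_mod_cnj) (intro mult_strict_right_mono; simp)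
  then show ?case
    by (auto simp: szego_at_1_Suc_diff)
qed

lemma norm_tau: "cmod (tau \<sigma> n) = 1"
  by (simp add: tau_def monic_op_eq monic_op_star_1 norm_divide)

section \<open>The parameters g, c and xi\<close>

definition tau_verblunsky :: "nat \<Rightarrow> complex" where
  "tau_verblunsky n = tau \<sigma> n * verblunsky \<sigma> n"

lemma norm_tau_verblunsky: "cmod (tau_verblunsky n) = cmod (verblunsky \<sigma> n)"
  by (simp add: tau_verblunsky_def norm_mult norm_tau)

text \<open>Keeps the denominators of \<open>g_param\<close> and \<open>c_param\<close> away from
  zero.\<close>

lemma Re_tau_verblunsky_less_1: "Re (tau_verblunsky n) < 1"
  using norm_verblunsky_less_1[of n] complex_Re_le_cmod[of "tau_verblunsky n"]
  by (simp add: norm_tau_verblunsky)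

lemma cnj_szego_at_1_Suc:
  "cnj (poly (szego \<sigma> (Suc n)) 1) = cnj (poly (szego \<sigma> n) 1) * (1 - tau_verblunsky n)"
  by (simp add: szego_at_1_Suc_diff tau_verblunsky_def tau_def monic_op_eq monic_op_star_1 field_simps)

text \<open>Expand |1 - w|^2 = 1 - 2 Re w + |w|^2, where w has the modulus of the Verblunsky
  coefficient since \<open>tau\<close> is unimodular.\<close>

lemma one_minus_g_param:
  "1 - g_param \<sigma> (Suc n)
     = (1 - (cmod (verblunsky \<sigma> n))\<^sup>2) / (2 * (1 - Re (tau_verblunsky n)))"
proof -
  define w where "w = tau_verblunsky n"
  have "1 - Re w \<noteq> 0" using Re_tau_verblunsky_less_1[of n] by (simp add: w_def)
  moreover have "(cmod (1 - w))\<^sup>2 = 1 - 2 * Re w + (cmod w)\<^sup>2"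
    by (simp only: cmod_power2) (simp add: power2_eq_square algebra_simps)
  ultimately have "1 - 1 / 2 * ((cmod (1 - w))\<^sup>2 / (1 - Re w)) = (1 - (cmod w)\<^sup>2) / (2 * (1 - Re w))"
    by (simp add: field_simps)
  moreover have "cmod w = cmod (verblunsky \<sigma> n)"
    by (simp add: w_def norm_tau_verblunsky)
  ultimately show ?thesis
    by (simp add: g_param_def w_def tau_verblunsky_def)
qed

lemma one_plus_c_param:
  "1 + \<i> * of_real (c_param \<sigma> (Suc n))
     = (1 - tau_verblunsky n) / of_real (1 - Re (tau_verblunsky n))"
proof -
  define w where "w = tau_verblunsky n"
  have "1 - Re w \<noteq> 0" "Re w - 1 \<noteq> 0"
    using Re_tau_verblunsky_less_1[of n] by (auto simp: w_def)
  then have "1 + \<i> * of_real (Im w / (Re w - 1)) = (1 - w) / of_real (1 - Re w)"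
    by (simp add: complex_eq_iff Re_divide_of_real Im_divide_of_real divide_simps algebra_simps)
  then show ?thesis by (simp add: c_param_def w_def tau_verblunsky_def)
qed

lemma xi_pos: "xi \<sigma> n > 0"
proof -
  have "1 - g_param \<sigma> (Suc j) > 0" for j
    using Re_tau_verblunsky_less_1[of j] norm_verblunsky_less_1[of j]
    by (simp add: one_minus_g_param power_less_one_iff abs_square_less_1)
  then have "1 - g_param \<sigma> j > 0" if "j \<in> {1..n}" for j
    using that by (cases j) auto
  then have "(\<Prod>j=1..n. 1 - g_param \<sigma> j) > 0"
    by (intro prod_pos) auto
  moreover have "(LINT z|\<sigma>. 1) > (0::real)"
    using sqnorm_pos[of 0] by (simp add: sqnorm_def ip_def)
  ultimately show ?thesis unfolding xi_def by (rule mult_pos_pos[rotated])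
qed

lemma xi_Suc: "xi \<sigma> (Suc n) = xi \<sigma> n * (1 - g_param \<sigma> (Suc n))"
  by (simp add: xi_def)

text \<open>The left side will be the leading coefficient of R_n. In each step the factor 1 -
  |\<alpha>|^2 of 1 - g cancels against the norm recurrence, and (1 - w) / (2 (1 - Re w)) remains;
  this is the origin of the halves.\<close>

lemma xi_szego_at_1:
  "of_real (xi \<sigma> n) * cnj (poly (szego \<sigma> n) 1) / of_real (sqnorm n)
     = (\<Prod>j=1..n. (1 + \<i> * of_real (c_param \<sigma> j)) / 2)"
proof (induction n)
  case 0
  have "xi \<sigma> 0 = sqnorm 0"
    by (simp add: xi_def sqnorm_def ip_def)
  then show ?case by simp
next
  case (Suc n)
  define w where "w = tau_verblunsky n"
  define t where "t = 1 - (cmod (verblunsky \<sigma> n))\<^sup>2"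
  have t: "t \<noteq> 0"
    using norm_verblunsky_less_1[of n] sqnorm_Suc[of n] sqnorm_nonzero[of "Suc n"]
    by (auto simp: t_def)
  have w: "1 - Re w \<noteq> 0" using Re_tau_verblunsky_less_1[of n] by (simp add: w_def)
  have "of_real (xi \<sigma> (Suc n)) * cnj (poly (szego \<sigma> (Suc n)) 1) / complex_of_real (sqnorm (Suc n))
      = (of_real (xi \<sigma> n) * cnj (poly (szego \<sigma> n) 1) / of_real (sqnorm n))
        * (of_real (t / (2 * (1 - Re w))) * (1 - w) / of_real t)"
    by (simp only: xi_Suc one_minus_g_param cnj_szego_at_1_Suc sqnorm_Suc of_real_mult
          flip: t_def w_def) (simp add: field_simps)
  also have "of_real (t / (2 * (1 - Re w))) * (1 - w) / of_real t
      = (1 - w) / complex_of_real (1 - Re w) / 2"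
    using t w by (simp add: field_simps)
  also have "\<dots> = (1 + \<i> * of_real (c_param \<sigma> (Suc n))) / 2"
    by (simp only: one_plus_c_param w_def)
  finally show ?case by (simp only: Suc.IH) simp
qed

subsection \<open>The Christoffel-Darboux kernel at 1\<close>

text \<open>The two square roots normalizing each orthonormal polynomial combine to 1 /
  \<open>sqnorm\<close>, so the kernel at w = 1 is written with monic polynomials, as a polynomial
  with coefficients and pairings.\<close>

definition kernel_poly :: "nat \<Rightarrow> complex poly" where
  "kernel_poly n = (\<Sum>k\<le>n. smult (cnj (poly (szego \<sigma> k) 1) / of_real (sqnorm k)) (szego \<sigma> k))"

lemma poly_kernel_poly: "poly (kernel_poly n) z = CD_kernel \<sigma> n z 1"
proof -
  have norm: "complex_of_real (1 / sqrt (sqnorm k)) * of_real (1 / sqrt (sqnorm k)) = 1 / of_real (sqnorm k)"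
    for k
  proof -
    have "1 / sqrt (sqnorm k) * (1 / sqrt (sqnorm k)) = 1 / sqnorm k" by simp
    then show ?thesis
      by (metis of_real_1 of_real_divide of_real_mult)
  qed
  show ?thesis
    unfolding kernel_poly_def CD_kernel_def orthonormal_poly_eq poly_sum
  proof (rule sum.cong[OF refl])
    fix k
    define s where "s = complex_of_real (1 / sqrt (sqnorm k))"
    have "cnj s = s" by (simp add: s_def)
    moreover have "s * s = 1 / of_real (sqnorm k)"
      unfolding s_def by (rule norm)
    ultimately show "poly (smult (cnj (poly (szego \<sigma> k) 1) / of_real (sqnorm k)) (szego \<sigma> k)) z
        = cnj (poly (smult (of_real (1 / sqrt (sqnorm k))) (szego \<sigma> k)) 1)
          * poly (smult (of_real (1 / sqrt (sqnorm k))) (szego \<sigma> k)) z"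
      unfolding s_def[symmetric] poly_smult complex_cnj_mult
      by (metis (no_types, lifting) mult.assoc mult.commute mult_1 times_divide_eq_left)
  qed
qed

lemma kernel_poly_Suc:
  "kernel_poly (Suc n) = kernel_poly n
     + smult (cnj (poly (szego \<sigma> (Suc n)) 1) / of_real (sqnorm (Suc n))) (szego \<sigma> (Suc n))"
  by (simp add: kernel_poly_def)

lemma degree_kernel_poly: "degree (kernel_poly n) \<le> n"
  unfolding kernel_poly_def
  by (intro degree_sum_le) (auto intro: order_trans[OF degree_smult_le])

lemma lead_coeff_kernel_poly:
  "coeff (kernel_poly n) n = cnj (poly (szego \<sigma> n) 1) / of_real (sqnorm n)"
proof (cases n)
  case 0
  then show ?thesis by (simp add: kernel_poly_def)
next
  case (Suc k)
  have "coeff (kernel_poly k) n = 0"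
    using degree_kernel_poly[of k] Suc by (intro coeff_eq_0) simp
  then show ?thesis
    using lead_coeff_szego[of n] by (simp add: Suc kernel_poly_Suc)
qed

text \<open>The value at 0 is the conjugate of the leading coefficient, reflecting the symmetry of
  the kernel at a point of the circle.\<close>

lemma kernel_poly_at_0: "poly (kernel_poly n) 0 = poly (szego \<sigma> n) 1 / of_real (sqnorm n)"
proof (induction n)
  case 0
  then show ?case by (simp add: kernel_poly_def)
next
  case (Suc n)
  define P b where "P = poly (szego \<sigma> n) 1" and "b = verblunsky \<sigma> n"
  have t: "1 - (cmod b)\<^sup>2 \<noteq> 0"
    using sqnorm_Suc[of n] sqnorm_nonzero[of "Suc n"] by (auto simp: b_def)
  \<comment> \<open>Numerator of the old value plus the new summand over the common denominator
    \<open>sqnorm (Suc n)\<close>. The terms in \<open>b * cnj b * P\<close> cancel and leave the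
    next value at 1.\<close>
  have "P * (1 - b * cnj b) - cnj b * (cnj P - b * P) = P - cnj b * cnj P"
    by (simp add: algebra_simps)
  then have key: "P * of_real (1 - (cmod b)\<^sup>2) - cnj b * (cnj P - b * P) = P - cnj b * cnj P"
    by (simp add: of_real_cmod_power2)
  have "poly (kernel_poly (Suc n)) 0
      = P / of_real (sqnorm n) + (cnj P - b * P) / of_real (sqnorm (Suc n)) * (- cnj b)"
    by (simp add: kernel_poly_Suc Suc szego_0_verblunsky szego_at_1_Suc_diff P_def b_def)
  also have "P / of_real (sqnorm n) = P * of_real (1 - (cmod b)\<^sup>2) / of_real (sqnorm (Suc n))"
  proof -
    have "complex_of_real (1 - (cmod b)\<^sup>2) \<noteq> 0"
      using t unfolding of_real_eq_0_iff .
    then show ?thesis by (simp only: sqnorm_Suc of_real_mult flip: b_def) simp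
  qed
  also have "\<dots> + (cnj P - b * P) / of_real (sqnorm (Suc n)) * (- cnj b)
      = (P * of_real (1 - (cmod b)\<^sup>2) - cnj b * (cnj P - b * P)) / of_real (sqnorm (Suc n))"
    by (simp add: diff_divide_distrib add_divide_distrib algebra_simps)
  finally show ?case
    by (simp only: key) (simp add: szego_at_1_Suc_diff P_def b_def)
qed

text \<open>Induction splits off the component of q along the monic orthogonal polynomial S of top
  degree; S sees only the new summand of the kernel, and the rest only the old kernel.\<close>

lemma kernel_poly_reproducing:
  "degree q \<le> n \<Longrightarrow> ip \<sigma> (kernel_poly n) q = cnj (poly q 1)"
proof (induction n arbitrary: q)
  case 0
  then obtain c where "q = [:c:]"
    by (auto elim: degree_eq_zeroE)
  then have "q = smult c (szego \<sigma> 0)" by simp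
  then show ?case
    by (simp add: kernel_poly_def ip_smult_left ip_smult_right ip_szego_szego del: szego.simps)
next
  case (Suc n)
  define S b r where "S = szego \<sigma> (Suc n)" and "b = coeff q (Suc n)" and "r = q - smult b S"
  have "coeff r (Suc n) = 0"
    using lead_coeff_szego[of "Suc n"] by (simp add: r_def S_def b_def)
  moreover have "degree r \<le> Suc n"
    unfolding r_def using Suc.prems
    by (intro degree_diff_le) (auto simp: S_def)
  ultimately have r: "degree r \<le> n"
    using le_degree[of r] eq_zero_or_degree_less[of r "Suc n"] by auto
  have q: "q = r - smult (- b) S"
    by (simp add: r_def)
  have "ip \<sigma> (kernel_poly n) S = 0"
    using degree_kernel_poly[of n] by (simp add: S_def ip_lower_szego)
  moreover have "ip \<sigma> S r = 0"
    using r by (simp add: S_def ip_szego_lower)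
  moreover have "ip \<sigma> S S = of_real (sqnorm (Suc n))"
    by (simp add: S_def ip_szego_szego)
  moreover have "ip \<sigma> (kernel_poly n) r = cnj (poly r 1)"
    using r by (rule Suc.IH)
  ultimately have "ip \<sigma> (kernel_poly (Suc n)) (r - smult (- b) S) = cnj (poly r 1) + cnj b * cnj (poly S 1)"
    by (simp add: kernel_poly_Suc ip_add_left ip_diff_right ip_smult_left ip_smult_right
          flip: S_def del: smult_minus_left)
  then show ?case by (simp add: q)
qed

definition R_poly :: "nat \<Rightarrow> complex poly" where
  "R_poly n = smult (of_real (xi \<sigma> n)) (kernel_poly n)"

lemma poly_R_poly: "poly (R_poly n) z = R_kernel \<sigma> n z"
  by (simp add: R_poly_def R_kernel_def poly_kernel_poly)

lemma degree_R_poly: "degree (R_poly n) \<le> n"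
  unfolding R_poly_def by (rule order_trans[OF degree_smult_le degree_kernel_poly])

lemma coeff_R_poly: "coeff (R_poly n) n = (\<Prod>j=1..n. (1 + \<i> * of_real (c_param \<sigma> j)) / 2)"
  unfolding xi_szego_at_1[symmetric] by (simp add: R_poly_def lead_coeff_kernel_poly)

text \<open>Conjugate of the leading coefficient, as \<open>xi\<close> and \<open>sqnorm\<close> are
  real.\<close>

lemma R_kernel_at_0: "R_kernel \<sigma> n 0 = (\<Prod>j=1..n. (1 - \<i> * of_real (c_param \<sigma> j)) / 2)"
proof -
  have "R_kernel \<sigma> n 0
      = cnj (of_real (xi \<sigma> n) * cnj (poly (szego \<sigma> n) 1) / of_real (sqnorm n))"
    by (simp add: kernel_poly_at_0 R_kernel_def flip: poly_kernel_poly)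
  then show ?thesis by (simp only: xi_szego_at_1) simp
qed

text \<open>Every power of z equals 1 at z = 1, so all these moments agree. The independence of k
  gives each term of the connection formula a single \<open>xi\<close> value.\<close>

lemma ip_R_poly_monom: "k \<le> n \<Longrightarrow> ip \<sigma> (R_poly n) (monom 1 k) = of_real (xi \<sigma> n)"
  by (simp add: R_poly_def ip_smult_left kernel_poly_reproducing degree_monom_eq poly_monom)

lemma degree_R_poly_eq: "degree (R_poly n) = n"
proof (rule antisym[OF degree_R_poly le_degree])
  show "coeff (R_poly n) n \<noteq> 0"
    unfolding coeff_R_poly by simp
qed

subsection \<open>The Christoffel transform\<close>

text \<open>The density is integrable, and the support loses at most the finitely many zeros of
  G.\<close>

lemma circle_measure_christoffel:
  assumes "G \<noteq> 0"
  shows "circle_measure (christoffel_measure G \<sigma>)"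
proof
  let ?\<nu> = "christoffel_measure G \<sigma>"
  have meas [measurable]: "(\<lambda>z. ennreal (cmod (poly G z))) \<in> borel_measurable \<sigma>"
  proof -
    have "(\<lambda>z. cmod (poly G z)) \<in> borel_measurable borel"
      by (intro borel_measurable_continuous_onI continuous_intros)
    then show ?thesis by simp
  qed
  have null_iff: "emeasure ?\<nu> A = 0 \<longleftrightarrow> (AE z in \<sigma>. ennreal (cmod (poly G z)) * indicator A z = 0)"
    if [measurable]: "A \<in> sets \<sigma>" for A
    unfolding christoffel_measure_def emeasure_density[OF meas that]
    by (rule nn_integral_0_iff_AE) simp
  have sets: "sets ?\<nu> = sets borel"
    by (simp add: christoffel_measure_def)
  have "integrable \<sigma> (\<lambda>z. cmod (poly G z))"
    by (intro integrable_norm integrable_continuous continuous_intros)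
  then have "(\<integral>\<^sup>+z. ennreal (cmod (poly G z)) \<partial>\<sigma>) < \<infinity>"
    by (simp add: integrable_iff_bounded)
  then have "finite_measure ?\<nu>"
    using emeasure_density[OF meas, of UNIV]
    by (intro finite_measureI) (simp add: christoffel_measure_def)
  moreover have "emeasure ?\<nu> (- sphere 0 1) = 0"
  proof -
    have "AE z in \<sigma>. ennreal (cmod (poly G z)) * indicator (- sphere 0 1) z = 0"
      using AE_circle by eventually_elim (simp add: indicator_def)
    moreover have "- sphere (0::complex) 1 \<in> sets \<sigma>"
      by (simp add: borel_closed)
    ultimately show ?thesis
      by (simp only: null_iff)
  qed
  moreover have "infinite (measure_supp ?\<nu>)"
  proof -
    have "measure_supp \<sigma> - {z. poly G z = 0} \<subseteq> measure_supp ?\<nu>"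
    proof
      fix z
      assume z: "z \<in> measure_supp \<sigma> - {z. poly G z = 0}"
      show "z \<in> measure_supp ?\<nu>"
        unfolding measure_supp_def
      proof (intro CollectI allI impI)
        fix U
        assume U: "open U \<and> z \<in> U"
        then have "U \<in> sets \<sigma>" by simp
        \<comment> \<open>On V the density is positive, so a null U for the new measure would make V
          null for \<sigma>, although V is an open neighbourhood of a support point.\<close>
        define V where "V = U \<inter> {z. poly G z \<noteq> 0}"
        have V: "open V"
          unfolding V_def using U by (intro open_Int open_Collect_neq continuous_intros) auto
        then have "emeasure \<sigma> V > 0"
          using z U by (auto simp: measure_supp_def V_def)
        show "emeasure ?\<nu> U > 0"
        proof (rule ccontr)
          assume "\<not> emeasure ?\<nu> U > 0"
          then have "emeasure ?\<nu> U = 0" by (simp add: not_gr_zero)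
          then have "AE z in \<sigma>. ennreal (cmod (poly G z)) * indicator U z = 0"
            by (simp only: null_iff[OF \<open>U \<in> sets \<sigma>\<close>])
          then have "AE z in \<sigma>. z \<notin> V"
            by eventually_elim (auto simp: V_def)
          then have "emeasure \<sigma> V = 0"
            using V by (subst (asm) AE_iff_measurable[of V]) auto
          with \<open>emeasure \<sigma> V > 0\<close> show False by simp
        qed
      qed
    qed
    moreover have "infinite (measure_supp \<sigma> - {z. poly G z = 0})"
      using nontrivial poly_roots_finite[OF assms]
      by (simp add: nontrivial_circle_measure_def)
    ultimately show ?thesis using finite_subset by blast
  qed
  ultimately show "nontrivial_circle_measure ?\<nu>"
    using sets by (simp add: nontrivial_circle_measure_def)
qed

text \<open>On the support |G(z)| = G(z) / z^m, and on the circle 1 / z^m is the conjugate of z^m,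
  which moves into the second argument.\<close>

lemma ip_christoffel:
  assumes "\<forall>\<zeta>\<in>measure_supp \<sigma>. poly G \<zeta> / \<zeta> ^ m \<in> \<real>\<^sub>\<ge>\<^sub>0"
  shows "ip (christoffel_measure G \<sigma>) p q = ip \<sigma> (G * p) (monom 1 m * q)"
proof -
  have [measurable]: "poly r \<in> borel_measurable borel" for r :: "complex poly"
    by (intro borel_measurable_continuous_onI continuous_intros)
  have [measurable]: "cnj \<in> borel_measurable borel"
    by (intro borel_measurable_continuous_onI continuous_intros)
  have "ip (christoffel_measure G \<sigma>) p q
      = (LINT z|\<sigma>. cmod (poly G z) *\<^sub>R (poly p z * cnj (poly q z)))"
    unfolding ip_def christoffel_measure_def by (rule integral_density) auto
  also have "\<dots> = ip \<sigma> (G * p) (monom 1 m * q)"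
    unfolding ip_def
  proof (rule integral_cong_AE)
    show "AE z in \<sigma>. cmod (poly G z) *\<^sub>R (poly p z * cnj (poly q z))
        = poly (G * p) z * cnj (poly (monom 1 m * q) z)"
      using AE_circle AE_measure_supp[OF sets_eq]
    proof eventually_elim
      case (elim z)
      then have r: "poly G z / z ^ m \<in> \<real>\<^sub>\<ge>\<^sub>0" using assms by simp
      have "z \<noteq> 0" using elim by auto
      have "complex_of_real (cmod (poly G z / z ^ m)) = poly G z / z ^ m"
        using r by (auto elim: nonneg_Reals_cases)
      moreover have "cmod (poly G z / z ^ m) = cmod (poly G z)"
        using elim by (simp add: norm_divide norm_power)
      moreover have "inverse (z ^ m) = cnj z ^ m"
        using elim by (simp add: cnj_eq_inverse_of_unit power_inverse)
      ultimately have "complex_of_real (cmod (poly G z)) = poly G z * cnj z ^ m"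
        by (simp add: divide_inverse)
      then show ?case
        by (simp add: scaleR_conv_of_real poly_monom algebra_simps)
    qed
  qed auto
  finally show ?thesis .
qed

end

lemma self_reciprocal_lead_coeff:
  assumes "self_reciprocal (degree G) G"
  shows "lead_coeff G = cnj (poly G 0)"
proof -
  have "poly (rev_poly G) z = poly G z" if "z \<noteq> 0" for z
    using assms that
    by (simp add: self_reciprocal_def rev_poly_def poly_reflect_poly_nz poly_map_poly_cnj
          inverse_eq_divide)
  \<comment> \<open>The identity is known only away from 0; the factor z extends it to all points
    and is cancelled afterwards.\<close>
  then have "poly (monom 1 1 * rev_poly G) = poly (monom 1 1 * G)"
    by (intro ext) (simp add: poly_monom, metis)
  then have "monom 1 1 * rev_poly G = monom 1 1 * G"
    by (simp only: poly_eq_poly_eq_iff)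
  then have "rev_poly G = G"
    by (simp add: monom_eq_0_iff)
  then have "poly G 0 = cnj (lead_coeff G)"
    using poly_rev_poly_0[of G] by simp
  then show ?thesis by simp
qed

subsection \<open>The connection formula\<close>

locale christoffel_connection =
  \<mu>: circle_measure \<mu> for \<mu> +
  fixes m :: nat and G :: "complex poly" and \<gamma> :: "nat \<Rightarrow> complex" and a :: "nat \<Rightarrow> nat \<Rightarrow> complex"
  assumes m: "m \<ge> 1"
    and degree_G: "degree G = 2 * m"
    and self_rec: "self_reciprocal (2 * m) G"
    and nonneg: "\<forall>\<zeta>\<in>measure_supp \<mu>. poly G \<zeta> / \<zeta> ^ m \<in> \<real>\<^sub>\<ge>\<^sub>0"
    and connection: "connection_coeffs \<mu> m G \<gamma> a"
begin

abbreviation "\<nu> \<equiv> christoffel_measure G \<mu>"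

lemma G_nonzero: "G \<noteq> 0"
  using degree_G m by auto

lemma lead_coeff_G: "coeff G (2 * m) = cnj (poly G 0)"
  using self_reciprocal_lead_coeff[of G] self_rec by (simp add: degree_G)

lemma G_at_0_nonzero: "poly G 0 \<noteq> 0"
  using lead_coeff_G G_nonzero by (metis complex_cnj_zero degree_G leading_coeff_0_iff)

sublocale \<nu>: circle_measure \<nu>
  by (rule \<mu>.circle_measure_christoffel[OF G_nonzero])

definition rhs_poly :: "nat \<Rightarrow> complex poly" where
  "rhs_poly n = \<mu>.R_poly (n + 2 * m)
     + (\<Sum>j=1..m. smult (a n (2 * j - 1)) (monom 1 (j - 1) * \<mu>.R_poly (n + 2 * m - 2 * j + 1)))
     + (\<Sum>j=1..m. smult (a n (2 * j)) (monom 1 j * \<mu>.R_poly (n + 2 * m - 2 * j)))"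

lemma poly_rhs_poly: "poly (rhs_poly n) z = connection_rhs \<mu> m a n z"
  by (simp add: rhs_poly_def connection_rhs_def poly_sum poly_monom \<mu>.poly_R_poly mult.assoc)

lemma rhs_poly_eq: "rhs_poly n = smult (\<gamma> n) (G * \<nu>.R_poly n)"
proof -
  have "poly (rhs_poly n) = poly (smult (\<gamma> n) (G * \<nu>.R_poly n))"
    using connection
    by (intro ext) (simp add: poly_rhs_poly connection_coeffs_def \<nu>.poly_R_poly flip: mult.assoc)
  then show ?thesis by (simp only: poly_eq_poly_eq_iff)
qed

lemma coeff_monom_mult_R_poly:
  assumes "k + i < n"
  shows "coeff (monom 1 k * \<mu>.R_poly i) n = 0"
proof (rule coeff_eq_0)
  have "degree (monom 1 k * \<mu>.R_poly i) \<le> k + i"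
    by (rule order_trans[OF degree_mult_le add_mono[OF degree_monom_le \<mu>.degree_R_poly]])
  with assms show "degree (monom 1 k * \<mu>.R_poly i) < n" by simp
qed

text \<open>With N = n + 2m, both summands with index j have degree at most N - j < N, so only R_N
  contributes to the coefficient of z^N.\<close>

lemma leading_coefficient_identity:
  "\<gamma> n * cnj (poly G 0) * (\<Prod>j=1..n. (1 + \<i> * of_real (c_param \<nu> j)) / 2)
     = (\<Prod>j=1..n + 2 * m. (1 + \<i> * of_real (c_param \<mu> j)) / 2)"
proof -
  have z1: "coeff (monom 1 (j - 1) * \<mu>.R_poly (n + 2 * m - 2 * j + 1)) (n + 2 * m) = 0"
    and z2: "coeff (monom 1 j * \<mu>.R_poly (n + 2 * m - 2 * j)) (n + 2 * m) = 0"
    if "j \<in> {1..m}" for j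
    using that by (auto intro!: coeff_monom_mult_R_poly)
  have "coeff (rhs_poly n) (n + 2 * m) = coeff (\<mu>.R_poly (n + 2 * m)) (n + 2 * m)"
    by (simp only: rhs_poly_def coeff_add coeff_sum coeff_smult z1 z2 cong: sum.cong) simp
  moreover have "coeff (G * \<nu>.R_poly n) (n + 2 * m) = coeff G (2 * m) * coeff (\<nu>.R_poly n) n"
    using coeff_mult_degree_sum[of G "\<nu>.R_poly n"]
    by (simp add: degree_G \<nu>.degree_R_poly_eq add.commute)
  ultimately show ?thesis
    by (simp only: rhs_poly_eq coeff_smult \<mu>.coeff_R_poly \<nu>.coeff_R_poly lead_coeff_G mult.assoc)
qed

text \<open>At 0 the first sum keeps only j = 1, where the power is 0^0 = 1, and the second sum
  vanishes. This is why a_1 alone enters the formulas for \<gamma> and c.\<close>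

lemma value_at_0_identity:
  "\<gamma> n * poly G 0 * (\<Prod>j=1..n. (1 - \<i> * of_real (c_param \<nu> j)) / 2)
     = (\<Prod>j=1..n + 2 * m. (1 - \<i> * of_real (c_param \<mu> j)) / 2)
       + a n 1 * (\<Prod>j=1..n + 2 * m - 1. (1 - \<i> * of_real (c_param \<mu> j)) / 2)"
proof -
  have "(\<Sum>j=1..m. a n (2 * j - 1) * 0 ^ (j - 1) * R_kernel \<mu> (n + 2 * m - 2 * j + 1) 0)
      = (\<Sum>j=1..m. if j = 1 then a n 1 * R_kernel \<mu> (n + 2 * m - 1) 0 else 0)"
    using m by (intro sum.cong) (auto simp: power_0_left Suc_diff_Suc numeral_2_eq_2)
  also have "\<dots> = a n 1 * R_kernel \<mu> (n + 2 * m - 1) 0"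
    using m by simp
  finally have s1: "(\<Sum>j=1..m. a n (2 * j - 1) * 0 ^ (j - 1) * R_kernel \<mu> (n + 2 * m - 2 * j + 1) 0)
      = a n 1 * R_kernel \<mu> (n + 2 * m - 1) 0" .
  have s2: "(\<Sum>j=1..m. a n (2 * j) * 0 ^ j * R_kernel \<mu> (n + 2 * m - 2 * j) 0) = 0"
    by (intro sum.neutral) auto
  have "\<gamma> n * poly G 0 * R_kernel \<nu> n 0 = connection_rhs \<mu> m a n 0"
    using connection by (simp add: connection_coeffs_def)
  then show ?thesis
    unfolding connection_rhs_def s1 s2 by (simp only: \<mu>.R_kernel_at_0 \<nu>.R_kernel_at_0 add_0_right)
qed

text \<open>Cancelling z^k leaves the moment of order m - k, within the range where the kernel
  reproduces.\<close>

lemma ip_monom_R_poly: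
  assumes "k \<le> m" "m - k \<le> i"
  shows "ip \<mu> (monom 1 k * \<mu>.R_poly i) (monom 1 m) = of_real (xi \<mu> i)"
proof -
  have "monom 1 m = monom (1::complex) k * monom 1 (m - k)"
    using assms by (simp add: mult_monom)
  then show ?thesis
    using assms by (simp only: \<mu>.ip_shift \<mu>.ip_R_poly_monom)
qed

text \<open>Pair the connection formula with z^m. On the right every kernel has index large enough
  to contribute its \<open>xi\<close>; on the left G and z^m turn \<mu> into \<nu>, and the moment
  of order 0 remains.\<close>

lemma integral_identity:
  "\<gamma> n * of_real (xi \<nu> n)
     = of_real (xi \<mu> (n + 2 * m))
       + (\<Sum>j=1..m. a n (2 * j - 1) * of_real (xi \<mu> (n + 2 * m - 2 * j + 1)))
       + (\<Sum>j=1..m. a n (2 * j) * of_real (xi \<mu> (n + 2 * m - 2 * j)))"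
proof -
  have "ip \<mu> (rhs_poly n) (monom 1 m)
      = of_real (xi \<mu> (n + 2 * m))
       + (\<Sum>j=1..m. a n (2 * j - 1) * of_real (xi \<mu> (n + 2 * m - 2 * j + 1)))
       + (\<Sum>j=1..m. a n (2 * j) * of_real (xi \<mu> (n + 2 * m - 2 * j)))"
    unfolding rhs_poly_def \<mu>.ip_add_left \<mu>.ip_sum_left \<mu>.ip_smult_left
    by (intro arg_cong2[where f = "(+)"] sum.cong refl arg_cong2[where f = "(*)"] ip_monom_R_poly
          \<mu>.ip_R_poly_monom) auto
  moreover have "ip \<mu> (rhs_poly n) (monom 1 m) = \<gamma> n * ip \<nu> (\<nu>.R_poly n) (monom 1 0)"
    by (simp add: rhs_poly_eq \<mu>.ip_smult_left \<mu>.ip_christoffel[OF nonneg] mult_monom)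
  ultimately show ?thesis
    by (simp only: \<nu>.ip_R_poly_monom[OF le0])
qed

section \<open>Ratios of consecutive connection constants\<close>

lemma gamma_nonzero: "\<gamma> n \<noteq> 0"
proof
  assume "\<gamma> n = 0"
  then have "(\<Prod>j=1..n + 2 * m. (1 + \<i> * of_real (c_param \<mu> j)) / 2) = 0"
    using leading_coefficient_identity[of n] by simp
  then show False by simp
qed

lemma gamma_0:
  "\<gamma> 0 = inverse (cnj (poly G 0)) * (\<Prod>j=1..2 * m. (1 + \<i> * of_real (c_param \<mu> j)) / 2)"
  using leading_coefficient_identity[of 0] G_at_0_nonzero by (simp add: field_simps)

text \<open>Quotient of the leading coefficient identities for n + 1 and n: the value of G and all
  but the last factor of each product cancel.\<close>

lemma gamma_Suc_plus:
  "\<gamma> (Suc n) / \<gamma> n * (1 + \<i> * of_real (c_param \<nu> (Suc n)))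
     = 1 + \<i> * of_real (c_param \<mu> (Suc n + 2 * m))"
proof -
  define p where "p = (\<Prod>j=1..n + 2 * m. (1 + \<i> * complex_of_real (c_param \<mu> j)) / 2)"
  define r where "r = (\<Prod>j=1..n. (1 + \<i> * complex_of_real (c_param \<nu> j)) / 2)"
  define x u where "x = 1 + \<i> * complex_of_real (c_param \<mu> (Suc n + 2 * m))"
    and "u = 1 + \<i> * complex_of_real (c_param \<nu> (Suc n))"
  have "p \<noteq> 0" by (simp add: p_def)
  have e1: "\<gamma> n * cnj (poly G 0) * r = p"
    unfolding p_def r_def by (rule leading_coefficient_identity)
  have e2: "\<gamma> (Suc n) * cnj (poly G 0) * (r * (u / 2)) = p * (x / 2)"
    using leading_coefficient_identity[of "Suc n"] by (simp add: p_def r_def x_def u_def)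
  \<comment> \<open>Replacing p by the left side of \<open>e1\<close> produces the left side of
    \<open>e2\<close>.\<close>
  have "p * (\<gamma> (Suc n) * u) = \<gamma> n * 2 * (\<gamma> (Suc n) * cnj (poly G 0) * (r * (u / 2)))"
    by (simp flip: e1)
  also have "\<dots> = p * (\<gamma> n * x)"
    unfolding e2 by simp
  finally have "p * (\<gamma> (Suc n) * u) = p * (\<gamma> n * x)" .
  then have "\<gamma> (Suc n) * u = \<gamma> n * x"
    using \<open>p \<noteq> 0\<close> by simp
  then have "\<gamma> (Suc n) / \<gamma> n * u = x"
    using gamma_nonzero[of n] by (simp add: field_simps)
  then show ?thesis by (simp only: x_def u_def)
qed

text \<open>Quotient of the identities at 0 for n + 1 and n. Their right sides share the product up
  to N - 2; clearing the halves turns a_1 into 2 a_1.\<close>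

lemma gamma_Suc_minus:
  fixes n :: nat
  defines "N \<equiv> Suc n + 2 * m"
  shows "\<gamma> (Suc n) / \<gamma> n * (1 - \<i> * of_real (c_param \<nu> (Suc n)))
     = (1 - \<i> * of_real (c_param \<mu> (N - 1)))
        * ((1 - \<i> * of_real (c_param \<mu> N) + 2 * a (Suc n) 1)
           / (1 - \<i> * of_real (c_param \<mu> (N - 1)) + 2 * a n 1))"
proof -
  \<comment> \<open>M = N - 2, a natural number index because m is positive.\<close>
  obtain M where M: "n + 2 * m = Suc M"
    using m by (cases "n + 2 * m") auto
  have N: "N = Suc (Suc M)" "N - 1 = Suc M"
    using M by (simp_all add: N_def)
  define q where "q = (\<Prod>j=1..M. (1 - \<i> * complex_of_real (c_param \<mu> j)) / 2)"
  define r where "r = (\<Prod>j=1..n. (1 - \<i> * complex_of_real (c_param \<nu> j)) / 2)"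
  define y y' v where "y = 1 - \<i> * complex_of_real (c_param \<mu> N)"
    and "y' = 1 - \<i> * complex_of_real (c_param \<mu> (N - 1))"
    and "v = 1 - \<i> * complex_of_real (c_param \<nu> (Suc n))"
  have "q \<noteq> 0" "r \<noteq> 0" by (simp_all add: q_def r_def)
  have e1: "\<gamma> n * poly G 0 * r = q * (y' / 2) + a n 1 * q"
    using value_at_0_identity[of n] by (simp add: M q_def r_def y'_def N)
  have e2: "\<gamma> (Suc n) * poly G 0 * (r * (v / 2))
      = q * (y' / 2) * (y / 2) + a (Suc n) 1 * (q * (y' / 2))"
    using value_at_0_identity[of "Suc n"] by (simp add: M q_def r_def y_def y'_def v_def N)
  \<comment> \<open>A zero denominator would annihilate the right side of \<open>e1\<close>, whose
    left side is a product of nonzero numbers.\<close>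
  have nz: "y' + 2 * a n 1 \<noteq> 0"
  proof
    assume "y' + 2 * a n 1 = 0"
    then have "q * (y' / 2) + a n 1 * q = 0" by algebra
    with e1 show False
      using gamma_nonzero[of n] G_at_0_nonzero \<open>r \<noteq> 0\<close> by simp
  qed
  have "q * (\<gamma> (Suc n) * v * (y' + 2 * a n 1)) = \<gamma> (Suc n) * v * 2 * (q * (y' / 2) + a n 1 * q)"
    by (simp add: algebra_simps)
  also have "\<dots> = 4 * \<gamma> n * (\<gamma> (Suc n) * poly G 0 * (r * (v / 2)))"
    unfolding e1[symmetric] by simp
  also have "\<dots> = q * (\<gamma> n * (y' * (y + 2 * a (Suc n) 1)))"
    unfolding e2 by (simp add: algebra_simps)
  finally have "q * (\<gamma> (Suc n) * v * (y' + 2 * a n 1)) = q * (\<gamma> n * (y' * (y + 2 * a (Suc n) 1)))" .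
  then have "\<gamma> (Suc n) * v * (y' + 2 * a n 1) = \<gamma> n * (y' * (y + 2 * a (Suc n) 1))"
    using \<open>q \<noteq> 0\<close> by simp
  then have "\<gamma> (Suc n) / \<gamma> n * v = y' * ((y + 2 * a (Suc n) 1) / (y' + 2 * a n 1))"
    using nz gamma_nonzero[of n] by (simp add: frac_eq_eq mult_ac)
  then show ?thesis by (simp only: y_def y'_def v_def)
qed

lemma xi_ratio: "of_real (g_param \<nu> (Suc n)) = 1 - complex_of_real (xi \<nu> (Suc n)) / of_real (xi \<nu> n)"
  using \<nu>.xi_pos[of n] by (simp add: \<nu>.xi_Suc)

end

text \<open>The factors 2 and 1/2 belong to the normalization of R_n. For the kernels 2^n R_n the
  coefficients become 2^j a_j and the constants 4^m \<gamma>_n, which removes these factors and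
  leaves the ratios of \<gamma> unchanged.\<close>

theorem theorem3p1:
  fixes \<mu> \<nu> :: "complex measure" and m :: nat and G :: "complex poly"
    and \<gamma> :: "nat \<Rightarrow> complex" and a :: "nat \<Rightarrow> nat \<Rightarrow> complex"
  assumes "nontrivial_circle_measure \<mu>"
    and "m \<ge> 1"
    and "degree G = 2 * m"
    and "self_reciprocal (2 * m) G"
    and "\<forall>\<zeta>\<in>measure_supp \<mu>. poly G \<zeta> / \<zeta> ^ m \<in> \<real>\<^sub>\<ge>\<^sub>0"
    and "\<nu> = christoffel_measure G \<mu>"
    and "connection_coeffs \<mu> m G \<gamma> a"
  shows "\<gamma> 0 = inverse (cnj (poly G 0)) * (\<Prod>j=1..2*m. (1 + \<i> * c_param \<mu> j) / 2) \<and>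
    (\<forall>n\<ge>1. \<forall>N. N = n + 2 * m \<longrightarrow>
      \<gamma> n / \<gamma> (n - 1) =
        1 / 2 * ((1 - \<i> * c_param \<mu> (N - 1))
                  * ((1 - \<i> * c_param \<mu> N + 2 * a n 1)
                     / (1 - \<i> * c_param \<mu> (N - 1) + 2 * a (n - 1) 1))
                 + (1 + \<i> * c_param \<mu> N)) \<and>
      complex_of_real (c_param \<nu> n) =
        \<i> / 2 * (\<gamma> (n - 1) / \<gamma> n)
          * ((1 - \<i> * c_param \<mu> (N - 1))
               * ((1 - \<i> * c_param \<mu> N + 2 * a n 1)
                  / (1 - \<i> * c_param \<mu> (N - 1) + 2 * a (n - 1) 1))
             - (1 + \<i> * c_param \<mu> N)) \<and>
      complex_of_real (g_param \<nu> n) =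
        1 - \<gamma> (n - 1) / \<gamma> n
          * ((xi \<mu> N + (\<Sum>j=1..m. a n (2 * j - 1) * xi \<mu> (N - 2 * j + 1))
                + (\<Sum>j=1..m. a n (2 * j) * xi \<mu> (N - 2 * j)))
             / (xi \<mu> (N - 1) + (\<Sum>j=1..m. a (n - 1) (2 * j - 1) * xi \<mu> (N - 2 * j))
                + (\<Sum>j=1..m. a (n - 1) (2 * j) * xi \<mu> (N - 2 * j - 1)))))"
proof -
  interpret christoffel_connection \<mu> m G \<gamma> a
    using assms by unfold_locales auto
  have "\<gamma> n / \<gamma> (n - 1) =
        1 / 2 * ((1 - \<i> * c_param \<mu> (N - 1))
                  * ((1 - \<i> * c_param \<mu> N + 2 * a n 1)
                     / (1 - \<i> * c_param \<mu> (N - 1) + 2 * a (n - 1) 1))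
                 + (1 + \<i> * c_param \<mu> N))" (is ?A)
    and "complex_of_real (c_param \<nu> n) =
        \<i> / 2 * (\<gamma> (n - 1) / \<gamma> n)
          * ((1 - \<i> * c_param \<mu> (N - 1))
               * ((1 - \<i> * c_param \<mu> N + 2 * a n 1)
                  / (1 - \<i> * c_param \<mu> (N - 1) + 2 * a (n - 1) 1))
             - (1 + \<i> * c_param \<mu> N))" (is ?B)
    and "complex_of_real (g_param \<nu> n) =
        1 - \<gamma> (n - 1) / \<gamma> n
          * ((xi \<mu> N + (\<Sum>j=1..m. a n (2 * j - 1) * xi \<mu> (N - 2 * j + 1))
                + (\<Sum>j=1..m. a n (2 * j) * xi \<mu> (N - 2 * j)))
             / (xi \<mu> (N - 1) + (\<Sum>j=1..m. a (n - 1) (2 * j - 1) * xi \<mu> (N - 2 * j))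
                + (\<Sum>j=1..m. a (n - 1) (2 * j) * xi \<mu> (N - 2 * j - 1))))" (is ?C)
    if "n \<ge> 1" and N: "N = n + 2 * m" for n N
  proof -
    obtain k where n: "n = Suc k"
      using \<open>n \<ge> 1\<close> by (cases n) auto
    note [simp] = gamma_nonzero
    define Q where "Q = (1 - \<i> * of_real (c_param \<mu> (N - 1)))
        * ((1 - \<i> * of_real (c_param \<mu> N) + 2 * a n 1)
           / (1 - \<i> * of_real (c_param \<mu> (N - 1)) + 2 * a k 1))"
    define x c \<rho> where "x = 1 + \<i> * complex_of_real (c_param \<mu> N)"
      and "c = complex_of_real (c_param \<nu> n)" and "\<rho> = \<gamma> n / \<gamma> k"
    have plus: "\<rho> * (1 + \<i> * c) = x"
      using gamma_Suc_plus[of k] by (simp add: x_def c_def \<rho>_def n N assms(6))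
    have minus: "\<rho> * (1 - \<i> * c) = Q"
      using gamma_Suc_minus[of k] by (simp add: Q_def c_def \<rho>_def n N assms(6))
    \<comment> \<open>In the sum of \<open>plus\<close> and \<open>minus\<close> the terms with c
      cancel; in their difference, used for the second claim, only these remain.\<close>
    have "\<rho> = 1 / 2 * (Q + x)"
      unfolding plus[symmetric] minus[symmetric] by (simp add: algebra_simps)
    then show ?A by (simp add: \<rho>_def Q_def x_def n)
    have "\<rho> \<noteq> 0" by (simp add: \<rho>_def)
    have "Q - x = \<rho> * (- 2 * \<i> * c)"
      unfolding plus[symmetric] minus[symmetric] by (simp add: algebra_simps)
    then have "\<i> / 2 * (1 / \<rho>) * (Q - x) = c"
      using \<open>\<rho> \<noteq> 0\<close> by simp
    then show ?B by (simp add: \<rho>_def Q_def x_def c_def n)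
    \<comment> \<open>The integral identity for n - 1, where (n - 1) + 2m - 2j + 1 = N - 2j; the one
      for n follows. In their quotient the \<gamma> factors cancel against the prefactor, leaving
      the ratio of \<open>xi\<close> values that is 1 - g_n.\<close>
    have "xi \<mu> (N - 1) + (\<Sum>j=1..m. a k (2 * j - 1) * xi \<mu> (N - 2 * j))
                + (\<Sum>j=1..m. a k (2 * j) * xi \<mu> (N - 2 * j - 1)) = \<gamma> k * xi \<nu> k"
      unfolding integral_identity[folded assms(6)]
      by (intro arg_cong2[where f = "(+)"] sum.cong refl arg_cong2[where f = "(*)"]
            arg_cong[where f = "\<lambda>i. complex_of_real (xi \<mu> i)"]) (auto simp: N n)
    moreover have "xi \<mu> N + (\<Sum>j=1..m. a n (2 * j - 1) * xi \<mu> (N - 2 * j + 1))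
                + (\<Sum>j=1..m. a n (2 * j) * xi \<mu> (N - 2 * j)) = \<gamma> n * xi \<nu> n"
      unfolding integral_identity[folded assms(6)] N ..
    moreover have "of_real (g_param \<nu> n) = 1 - \<gamma> k / \<gamma> n * (\<gamma> n * xi \<nu> n / (\<gamma> k * xi \<nu> k))"
      using xi_ratio[of k] by (simp add: n assms(6))
    ultimately show ?C by (simp only: n diff_Suc_1)
  qed
  then show ?thesis using gamma_0 by blast
qed

end
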